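(* Let $G$ be a finite group and $H \subseteq G$ a subgroup of index $n$. Let $C_3 = \mu_3 \subset \mathbb C^\times$. Fix representatives $X_1, \dots, X_n$ of the left cosets $G/H$ with $X_1 H = H$, and let $G$ act on $C_3^n$ by permuting the coordinates according to its action on the cosets $X_1H, \dots, X_nH$. Put $\tilde G = C_3^n \rtimes G$ and $\tilde H = C_3^n \rtimes H$, and let $\chi : \tilde H \to C_3$ be the projection to the first coordinate, $\chi(\zeta_1, \dots, \zeta_n, h) = \zeta_1$. Let $\tilde H' \subseteq \tilde G$ be any subgroup and $\chi' : \tilde H' \to \mathbb C^\times$ any character (homomorphism). Put $U_{\tilde H, \chi} = \ker(\chi)$ and $U_{\tilde H', \chi'} = \ker(\chi')$. Suppose that $\mathrm{Ind}_{\tilde H}^{\tilde G}(1) \simeq \mathrm{Ind}_{\tilde H'}^{\tilde G}(1)$ and $\mathrm{Ind}_{U_{\tilde H,\chi}}^{\tilde G}(1) \simeq \mathrm{Ind}_{U_{\tilde H',\chi'}}^{\tilde G}(1)$, where $1$ denotes the trivial one-dimensional representation. Then either $\mathrm{Ind}_{\tilde H}^{\tilde G}(\chi) \simeq \mathrm{Ind}_{\tilde H'}^{\tilde G}(\chi')$ or $\mathrm{Ind}_{\tilde H}^{\tilde G}(\chi) \simeq \mathrm{Ind}_{\tilde H'}^{\tilde G}(\bar\chi')$.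
   Context: All representations are finite-dimensional complex representations; $\bar\chi'$ denotes the complex conjugate character of $\chi'$. *)

theory Defs
  imports
    Complex_Main
    "HOL-Algebra.Left_Coset"
    "HOL-Algebra.Product_Groups"
    "HOL-Library.Function_Algebras"
begin

section \<open>Finite-dimensional complex representations\<close>

text \<open>
  The underlying space of a representation is a subspace \<open>rep_space\<close> of an ambient
  complex vector space, whose addition is that of the type and whose scalar multiplication is
  \<open>rep_scale\<close> (there is no type class of complex vector spaces).
  The value of \<open>rep_act\<close> is only meaningful on the group and on \<open>rep_space\<close>.
\<close>

record ('g, 'v) rep =
  rep_space :: "'v set"
  rep_scale :: "complex \<Rightarrow> 'v \<Rightarrow> 'v"
  rep_act :: "'g \<Rightarrow> 'v \<Rightarrow> 'v"

locale fd_representation = group G + vs: vector_space "rep_scale R"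
  for G (structure) and R :: "('g, 'v::ab_group_add) rep" +
  assumes subspace: "vs.subspace (rep_space R)"
    and fin_dim: "\<exists>B. finite B \<and> rep_space R = vs.span B"
    and act_closed: "\<lbrakk>g \<in> carrier G; v \<in> rep_space R\<rbrakk> \<Longrightarrow> rep_act R g v \<in> rep_space R"
    and act_add: "\<lbrakk>g \<in> carrier G; v \<in> rep_space R; w \<in> rep_space R\<rbrakk>
      \<Longrightarrow> rep_act R g (v + w) = rep_act R g v + rep_act R g w"
    and act_scale: "\<lbrakk>g \<in> carrier G; v \<in> rep_space R\<rbrakk>
      \<Longrightarrow> rep_act R g (rep_scale R c v) = rep_scale R c (rep_act R g v)"
    and act_one: "v \<in> rep_space R \<Longrightarrow> rep_act R \<one> v = v"
    and act_mult: "\<lbrakk>g \<in> carrier G; h \<in> carrier G; v \<in> rep_space R\<rbrakk>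
      \<Longrightarrow> rep_act R (g \<otimes> h) v = rep_act R g (rep_act R h v)"

definition rep_isomorphic ::
  "('g, 'm) monoid_scheme \<Rightarrow> ('g, 'v::ab_group_add) rep \<Rightarrow> ('g, 'w::ab_group_add) rep \<Rightarrow> bool"
  where "rep_isomorphic G R S \<longleftrightarrow>
    (\<exists>T. bij_betw T (rep_space R) (rep_space S) \<and>
      (\<forall>v\<in>rep_space R. \<forall>w\<in>rep_space R. T (v + w) = T v + T w) \<and>
      (\<forall>c. \<forall>v\<in>rep_space R. T (rep_scale R c v) = rep_scale S c (T v)) \<and>
      (\<forall>g\<in>carrier G. \<forall>v\<in>rep_space R. T (rep_act R g v) = rep_act S g (T v)))"

text \<open>
  The induced representation, in the function model: \<open>H\<close>-equivariant functions from \<open>G\<close> to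
  the given representation \<open>R\<close> of \<open>H\<close>, with \<open>G\<close> acting by left translation. Functions are
  normalised to be zero outside the carrier.
\<close>

definition induced_rep ::
  "('g, 'm) monoid_scheme \<Rightarrow> 'g set \<Rightarrow> ('g, 'v::ab_group_add) rep \<Rightarrow> ('g, 'g \<Rightarrow> 'v) rep"
  where "induced_rep G H R =
    \<lparr>rep_space = {f. (\<forall>x\<in>carrier G. f x \<in> rep_space R) \<and>
        (\<forall>x\<in>carrier G. \<forall>h\<in>H. f (x \<otimes>\<^bsub>G\<^esub> h) = rep_act R (inv\<^bsub>G\<^esub> h) (f x)) \<and>
        (\<forall>x. x \<notin> carrier G \<longrightarrow> f x = 0)},
     rep_scale = (\<lambda>c f x. rep_scale R c (f x)),
     rep_act = (\<lambda>g f x. if x \<in> carrier G then f (inv\<^bsub>G\<^esub> g \<otimes>\<^bsub>G\<^esub> x) else 0)\<rparr>"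

definition character_rep :: "('g \<Rightarrow> complex) \<Rightarrow> ('g, complex) rep"
  where "character_rep \<chi> =
    \<lparr>rep_space = UNIV, rep_scale = (*), rep_act = (\<lambda>g z. \<chi> g * z)\<rparr>"

definition trivial_rep :: "('g, complex) rep"
  where "trivial_rep = character_rep (\<lambda>_. 1)"

definition complex_units :: "complex monoid"
  where "complex_units = \<lparr>carrier = - {0}, mult = (*), one = 1\<rparr>"

definition C3 :: "complex monoid"
  where "C3 = complex_units\<lparr>carrier := {z. z ^ 3 = 1}\<rparr>"


section \<open>The semidirect product of \<open>C3 ^ n\<close> and \<open>G\<close>\<close>

definition semidirect_product ::
  "('a, 'm) monoid_scheme \<Rightarrow> ('g, 'k) monoid_scheme \<Rightarrow> ('g \<Rightarrow> 'a \<Rightarrow> 'a) \<Rightarrow> ('a \<times> 'g) monoid"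
  where "semidirect_product N G \<phi> =
    \<lparr>carrier = carrier N \<times> carrier G,
     mult = (\<lambda>(a, g) (b, h). (a \<otimes>\<^bsub>N\<^esub> \<phi> g b, g \<otimes>\<^bsub>G\<^esub> h)),
     one = (\<one>\<^bsub>N\<^esub>, \<one>\<^bsub>G\<^esub>)\<rparr>"

definition C3_power :: "nat \<Rightarrow> (nat \<Rightarrow> complex) monoid"
  where "C3_power n = product_group {1..n} (\<lambda>_. C3)"

text \<open>The index \<open>j\<close> with \<open>g X\<^sub>i H = X\<^sub>j H\<close>.\<close>

definition coset_perm ::
  "('g, 'm) monoid_scheme \<Rightarrow> 'g set \<Rightarrow> nat \<Rightarrow> (nat \<Rightarrow> 'g) \<Rightarrow> 'g \<Rightarrow> nat \<Rightarrow> nat"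
  where "coset_perm G H n X g i =
    (THE j. j \<in> {1..n} \<and> (g \<otimes>\<^bsub>G\<^esub> X i) <#\<^bsub>G\<^esub> H = X j <#\<^bsub>G\<^esub> H)"

text \<open>
  The element \<open>g\<close> moves the coordinate at \<open>i\<close> to the position \<open>coset_perm G H n X g i\<close>;
  the inverse below makes this a left action.
\<close>

definition coset_action ::
  "('g, 'm) monoid_scheme \<Rightarrow> 'g set \<Rightarrow> nat \<Rightarrow> (nat \<Rightarrow> 'g) \<Rightarrow> 'g \<Rightarrow> (nat \<Rightarrow> complex) \<Rightarrow> (nat \<Rightarrow> complex)"
  where "coset_action G H n X g \<zeta> = (\<lambda>j\<in>{1..n}. \<zeta> (coset_perm G H n X (inv\<^bsub>G\<^esub> g) j))"

definition G_tilde ::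
  "('g, 'm) monoid_scheme \<Rightarrow> 'g set \<Rightarrow> nat \<Rightarrow> (nat \<Rightarrow> 'g) \<Rightarrow> ((nat \<Rightarrow> complex) \<times> 'g) monoid"
  where "G_tilde G H n X = semidirect_product (C3_power n) G (coset_action G H n X)"

definition H_tilde :: "'g set \<Rightarrow> nat \<Rightarrow> ((nat \<Rightarrow> complex) \<times> 'g) set"
  where "H_tilde H n = carrier (C3_power n) \<times> H"

definition first_coordinate :: "(nat \<Rightarrow> complex) \<times> 'g \<Rightarrow> complex"
  where "first_coordinate = (\<lambda>(\<zeta>, h). \<zeta> 1)"


section \<open>Well-formedness of the definitions\<close>

lemma group_complex_units: "group complex_units"
  by (rule groupI) (auto simp: complex_units_def intro!: bexI[of _ "inverse _"])

lemma subgroup_C3: "subgroup {z. z ^ 3 = 1} complex_units"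
proof (rule group.subgroupI[OF group_complex_units])
  show "{z. z ^ 3 = 1} \<subseteq> carrier complex_units"
    by (auto simp: complex_units_def)
  show "{z::complex. z ^ 3 = 1} \<noteq> {}" by (auto intro: exI[of _ 1])
next
  fix a :: complex assume a: "a \<in> {z. z ^ 3 = 1}"
  then have "a \<noteq> 0" by auto
  then have "inv\<^bsub>complex_units\<^esub> a = inverse a"
    by (intro group.inv_equality[OF group_complex_units]) (auto simp: complex_units_def)
  with a show "inv\<^bsub>complex_units\<^esub> a \<in> {z. z ^ 3 = 1}"
    by (simp add: power_inverse)
next
  fix a b :: complex assume "a \<in> {z. z ^ 3 = 1}" "b \<in> {z. z ^ 3 = 1}"
  then show "a \<otimes>\<^bsub>complex_units\<^esub> b \<in> {z. z ^ 3 = 1}"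
    by (simp add: complex_units_def power_mult_distrib)
qed

lemma group_C3: "group C3"
  unfolding C3_def by (rule subgroup.subgroup_is_group[OF subgroup_C3 group_complex_units])

lemma group_C3_power: "group (C3_power n)"
  unfolding C3_power_def by (simp add: group_C3)

lemma C3_simps [simp]:
  "carrier C3 = {z. z ^ 3 = 1}" "x \<otimes>\<^bsub>C3\<^esub> y = x * y" "\<one>\<^bsub>C3\<^esub> = 1"
  by (simp_all add: C3_def complex_units_def)

locale coset_setup = group G for G :: "('a, 'm) monoid_scheme" (structure) +
  fixes H and n :: nat and X :: "nat \<Rightarrow> 'a"
  assumes H: "subgroup H G"
    and X_carrier: "i \<in> {1..n} \<Longrightarrow> X i \<in> carrier G"
    and X_bij: "bij_betw (\<lambda>i. X i <# H) {1..n} (lcosets H)"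
begin

lemma H_subset: "H \<subseteq> carrier G"
  using H by (rule subgroup.subset)

lemma coset_perm_unique:
  assumes "g \<in> carrier G" "i \<in> {1..n}"
  shows "\<exists>!j. j \<in> {1..n} \<and> (g \<otimes> X i) <# H = X j <# H"
proof -
  have "(g \<otimes> X i) <# H \<in> lcosets H"
    using assms X_carrier by (auto simp: LCOSETS_def)
  then have "(g \<otimes> X i) <# H \<in> (\<lambda>i. X i <# H) ` {1..n}"
    by (simp only: bij_betw_imp_surj_on[OF X_bij])
  then obtain j where j: "j \<in> {1..n}" "(g \<otimes> X i) <# H = X j <# H"
    by (elim imageE) simp
  then have "k = j" if "k \<in> {1..n}" "(g \<otimes> X i) <# H = X k <# H" for k
    using inj_onD[OF bij_betw_imp_inj_on[OF X_bij] _ that(1) j(1)] that(2) by simp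
  with j show ?thesis by blast
qed

lemma coset_perm:
  assumes "g \<in> carrier G" "i \<in> {1..n}"
  shows coset_perm_in: "coset_perm G H n X g i \<in> {1..n}"
    and coset_perm_coset: "(g \<otimes> X i) <# H = X (coset_perm G H n X g i) <# H"
  using theI'[OF coset_perm_unique[OF assms]] unfolding coset_perm_def by auto

lemma coset_perm_eqI:
  assumes "g \<in> carrier G" "i \<in> {1..n}" "j \<in> {1..n}" "(g \<otimes> X i) <# H = X j <# H"
  shows "coset_perm G H n X g i = j"
  using coset_perm[OF assms(1,2)] coset_perm_unique[OF assms(1,2)] assms(3,4) by blast

lemma coset_perm_one:
  assumes "i \<in> {1..n}" shows "coset_perm G H n X \<one> i = i"
  using assms X_carrier by (intro coset_perm_eqI) auto

lemma coset_perm_mult: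
  assumes "g \<in> carrier G" "h \<in> carrier G" "i \<in> {1..n}"
  shows "coset_perm G H n X (g \<otimes> h) i = coset_perm G H n X g (coset_perm G H n X h i)"
proof (rule coset_perm_eqI)
  let ?k = "coset_perm G H n X h i"
  have k: "?k \<in> {1..n}" using assms by (intro coset_perm_in)
  show "g \<otimes> h \<in> carrier G" "i \<in> {1..n}" using assms by auto
  show "coset_perm G H n X g ?k \<in> {1..n}" using assms k by (intro coset_perm_in)
  have "(g \<otimes> h \<otimes> X i) <# H = g <# ((h \<otimes> X i) <# H)"
    using assms X_carrier H_subset by (simp add: lcos_m_assoc m_assoc)
  also have "\<dots> = g <# (X ?k <# H)"
    using assms coset_perm_coset by simp
  also have "\<dots> = (g \<otimes> X ?k) <# H"
    using assms k X_carrier H_subset by (simp add: lcos_m_assoc)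
  also have "\<dots> = X (coset_perm G H n X g ?k) <# H"
    using assms k by (intro coset_perm_coset)
  finally show "(g \<otimes> h \<otimes> X i) <# H = X (coset_perm G H n X g ?k) <# H" .
qed

lemma coset_action_perm:
  assumes "g \<in> carrier G" "i \<in> {1..n}"
  shows "coset_action G H n X g \<zeta> (coset_perm G H n X g i) = \<zeta> i"
proof -
  have "coset_perm G H n X (inv g) (coset_perm G H n X g i) = i"
    using coset_perm_mult[of "inv g" g i] assms by (simp add: coset_perm_one)
  then show ?thesis using coset_perm_in[OF assms] by (simp add: coset_action_def)
qed

lemma carrier_C3_power: "carrier (C3_power n) = (\<Pi>\<^sub>E i\<in>{1..n}. {z. z ^ 3 = 1})"
  by (simp add: C3_power_def)

lemma coset_action_closed:
  assumes "g \<in> carrier G" "\<zeta> \<in> carrier (C3_power n)"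
  shows "coset_action G H n X g \<zeta> \<in> carrier (C3_power n)"
  using assms coset_perm_in[of "inv g"]
  unfolding carrier_C3_power coset_action_def by (auto simp: PiE_iff)

lemma coset_action_one:
  assumes "\<zeta> \<in> carrier (C3_power n)"
  shows "coset_action G H n X \<one> \<zeta> = \<zeta>"
  using assms unfolding carrier_C3_power coset_action_def
  by (intro ext) (auto simp: coset_perm_one PiE_iff extensional_def restrict_def)

lemma coset_action_mult:
  assumes "g \<in> carrier G" "h \<in> carrier G"
  shows "coset_action G H n X (g \<otimes> h) \<zeta> = coset_action G H n X g (coset_action G H n X h \<zeta>)"
  using assms coset_perm_in[of "inv g"] unfolding coset_action_def
  by (intro ext) (auto simp: inv_mult_group coset_perm_mult)

lemma coset_action_distrib:
  assumes "g \<in> carrier G"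
  shows "coset_action G H n X g (\<zeta> \<otimes>\<^bsub>C3_power n\<^esub> \<xi>) =
    coset_action G H n X g \<zeta> \<otimes>\<^bsub>C3_power n\<^esub> coset_action G H n X g \<xi>"
  using assms coset_perm_in[of "inv g"] unfolding coset_action_def C3_power_def
  by (intro ext) (auto simp: restrict_def)

lemma group_G_tilde: "group (G_tilde G H n X)"
proof -
  interpret N: group "C3_power n" by (rule group_C3_power)
  show ?thesis
    unfolding G_tilde_def semidirect_product_def
  proof (rule groupI, goal_cases)
    case (5 x)
    obtain a g where x: "x = (a, g)" "a \<in> carrier (C3_power n)" "g \<in> carrier G"
      using 5 by auto
    let ?b = "coset_action G H n X (inv g) (inv\<^bsub>C3_power n\<^esub> a)"
    have "?b \<otimes>\<^bsub>C3_power n\<^esub> coset_action G H n X (inv g) a = \<one>\<^bsub>C3_power n\<^esub>"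
    proof -
      let ?f = "coset_action G H n X (inv g)"
      have "?f \<one>\<^bsub>C3_power n\<^esub> \<otimes>\<^bsub>C3_power n\<^esub> ?f \<one>\<^bsub>C3_power n\<^esub> = ?f \<one>\<^bsub>C3_power n\<^esub>"
        using x by (simp flip: coset_action_distrib)
      then have "?f \<one>\<^bsub>C3_power n\<^esub> = \<one>\<^bsub>C3_power n\<^esub>"
        using x coset_action_closed[of "inv g"] by (simp add: N.l_cancel_one)
      then show ?thesis using x by (simp flip: coset_action_distrib)
    qed
    with x coset_action_closed show ?case
      by (intro bexI[of _ "(?b, inv g)"]) auto
  qed (auto simp: coset_action_closed coset_action_one coset_action_mult coset_action_distrib
        m_assoc N.m_assoc)
qed

lemma subgroup_H_tilde: "subgroup (H_tilde H n) (G_tilde G H n X)"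
proof -
  interpret N: group "C3_power n" by (rule group_C3_power)
  interpret T: group "G_tilde G H n X" by (rule group_G_tilde)
  interpret H: subgroup H G by (rule H)
  have car: "carrier (G_tilde G H n X) = carrier (C3_power n) \<times> carrier G"
    by (simp add: G_tilde_def semidirect_product_def)
  show ?thesis
  proof (rule T.subgroupI)
    show "H_tilde H n \<subseteq> carrier (G_tilde G H n X)"
      using H_subset by (auto simp: H_tilde_def car)
    show "H_tilde H n \<noteq> {}" unfolding H_tilde_def using H.one_closed N.one_closed by blast
  next
    fix x assume x: "x \<in> H_tilde H n"
    then have xG: "x \<in> carrier (G_tilde G H n X)" using H_subset by (auto simp: H_tilde_def car)
    obtain b k where y: "inv\<^bsub>G_tilde G H n X\<^esub> x = (b, k)" by fastforce
    with T.inv_closed[OF xG] have bk: "b \<in> carrier (C3_power n)" "k \<in> carrier G"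
      by (auto simp: car)
    have "k \<otimes> snd x = \<one>"
      using T.l_inv[OF xG] unfolding y
      by (cases x) (auto simp: G_tilde_def semidirect_product_def)
    then have "k = inv (snd x)" using bk x H_subset
      by (intro inv_equality[symmetric]) (auto simp: H_tilde_def)
    with x bk y show "inv\<^bsub>G_tilde G H n X\<^esub> x \<in> H_tilde H n" by (auto simp: H_tilde_def)
  next
    fix x y assume "x \<in> H_tilde H n" "y \<in> H_tilde H n"
    then show "x \<otimes>\<^bsub>G_tilde G H n X\<^esub> y \<in> H_tilde H n"
      using H_subset
      by (auto simp: H_tilde_def G_tilde_def semidirect_product_def coset_action_closed subset_iff)
  qed
qed

lemma first_coordinate_hom:
  assumes X1: "X 1 <# H = H"
  shows "first_coordinate \<in> hom ((G_tilde G H n X)\<lparr>carrier := H_tilde H n\<rparr>) C3"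
proof -
  interpret H: subgroup H G by (rule H)
  have "H \<in> lcosets H"
    using lcos_mult_one[OF H_subset] unfolding LCOSETS_def by force
  then have n: "1 \<in> {1..n}"
    using bij_betw_imp_surj_on[OF X_bij] by (cases n) auto
  have "coset_perm G H n X h 1 = 1" if h: "h \<in> H" for h
  proof (rule coset_perm_eqI)
    have "(h \<otimes> X 1) <# H = h <# (X 1 <# H)"
      using h n X_carrier H_subset by (intro lcos_m_assoc[symmetric]) auto
    then show "(h \<otimes> X 1) <# H = X 1 <# H"
      using X1 h H coset_join3[of h H] by (simp add: H.mem_carrier)
  qed (use h n in auto)
  then show ?thesis
    using n H_subset
    by (auto simp: hom_def first_coordinate_def H_tilde_def G_tilde_def semidirect_product_def
        carrier_C3_power coset_action_def PiE_iff C3_power_def)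
qed

end

lemma fd_representation_character:
  fixes G (structure)
  assumes "group G" "\<chi> \<in> hom G complex_units"
  shows "fd_representation G (character_rep \<chi>)"
proof -
  interpret group G by fact
  interpret vs: vector_space "(*) :: complex \<Rightarrow> complex \<Rightarrow> complex"
    by standard (auto simp: algebra_simps)
  interpret h: group_hom G complex_units \<chi>
    by (simp add: group_hom_def group_hom_axioms_def assms group_complex_units)
  have span: "vs.span {1} = UNIV"
    by (auto simp: vs.span_singleton image_iff)
  have vs: "vector_space (rep_scale (character_rep \<chi>))"
    by (simp add: character_rep_def vs.vector_space_axioms)
  show ?thesis
  proof (intro fd_representation.intro fd_representation_axioms.intro group_axioms vs)
    show "module.subspace (rep_scale (character_rep \<chi>)) (rep_space (character_rep \<chi>))"
      by (simp add: character_rep_def vs.subspace_UNIV)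
    show "\<exists>B. finite B \<and> rep_space (character_rep \<chi>) = module.span (rep_scale (character_rep \<chi>)) B"
      by (rule exI[of _ "{1}"]) (simp add: character_rep_def span)
    show "rep_act (character_rep \<chi>) \<one> v = v" for v
      using h.hom_one by (simp add: character_rep_def complex_units_def)
    show "rep_act (character_rep \<chi>) (g \<otimes> k) v =
        rep_act (character_rep \<chi>) g (rep_act (character_rep \<chi>) k v)"
      if "g \<in> carrier G" "k \<in> carrier G" for g k v
      using h.hom_mult[OF that] by (simp add: character_rep_def complex_units_def)
  qed (simp_all only: character_rep_def rep.simps distrib_left mult.left_commute UNIV_I)
qed

lemma fd_representation_induced:
  fixes G :: "('a, 'm) monoid_scheme" (structure) and R :: "('a, 'b::ab_group_add) rep"
  assumes "group G" "finite (carrier G)" "subgroup H G"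
    and R: "fd_representation (G\<lparr>carrier := H\<rparr>) R"
  shows "fd_representation G (induced_rep G H R)"
proof -
  interpret group G by fact
  interpret H: subgroup H G by fact
  interpret R: fd_representation "G\<lparr>carrier := H\<rparr>" R by fact
  let ?I = "induced_rep G H R"
  let ?s = "\<lambda>c (f :: 'a \<Rightarrow> 'b) x. rep_scale R c (f x)"
  interpret F: vector_space ?s
    by standard (auto simp: fun_eq_iff R.vs.scale_left_distrib R.vs.scale_right_distrib)
  have sc: "rep_scale ?I = ?s" by (simp add: induced_rep_def)
  note R_mems = R.vs.subspace_0[OF R.subspace] R.vs.subspace_add[OF R.subspace]
    R.vs.subspace_scale[OF R.subspace]
  have act0: "rep_act R h 0 = 0" if "h \<in> H" for h
    using R.act_add[of h 0 0] that R_mems by simp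
  have sub: "F.subspace (rep_space ?I)"
    unfolding induced_rep_def using R_mems R.act_add R.act_scale act0
    by (auto simp: F.subspace_def)
  obtain B where B: "finite B" "rep_space R = R.vs.span B" using R.fin_dim by auto
  define D where "D = (\<lambda>(g, b) x. if x = g then b else 0) ` (carrier G \<times> B)"
  have finD: "finite D" using assms(2) B(1) by (simp add: D_def)
  have delta: "(\<lambda>x. if x = g then v else 0) \<in> F.span D" if g: "g \<in> carrier G" and v: "v \<in> R.vs.span B" for g v
    using v
  proof (induction rule: R.vs.span_induct_alt)
    case base
    have "(\<lambda>x. if x = g then 0 else 0) = (0 :: 'a \<Rightarrow> 'b)" by auto
    then show ?case by (simp add: F.span_zero)
  next
    case (step c b w)
    have "(\<lambda>x. if x = g then b else 0) \<in> F.span D"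
      by (rule F.span_base) (use g step in \<open>force simp: D_def\<close>)
    from F.span_add[OF F.span_scale[OF this, of c] step(2)]
    show ?case by (rule back_subst[of "\<lambda>f. f \<in> F.span D"]) auto
  qed
  have "rep_space ?I \<subseteq> F.span D"
  proof
    fix f assume f: "f \<in> rep_space ?I"
    have "f = (\<Sum>g\<in>carrier G. (\<lambda>x. if x = g then f g else 0))"
    proof
      fix x
      have "(\<Sum>g\<in>A. (\<lambda>x. if x = g then f g else 0)) x = (\<Sum>g\<in>A. if x = g then f g else 0)" for A
        by (induction A rule: infinite_finite_induct) auto
      then show "f x = (\<Sum>g\<in>carrier G. (\<lambda>x. if x = g then f g else 0)) x"
        using f assms(2) by (auto simp: induced_rep_def)
    qed
    also have "\<dots> \<in> F.span D"
      using f B(2) by (intro F.span_sum delta) (auto simp: induced_rep_def)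
    finally show "f \<in> F.span D" .
  qed
  moreover obtain C where C: "C \<subseteq> rep_space ?I" "F.independent C" "rep_space ?I \<subseteq> F.span C"
    using F.maximal_independent_subset by blast
  ultimately have "finite C" using F.independent_span_bound[OF finD] by blast
  moreover have "rep_space ?I = F.span C"
    using C F.span_minimal[OF C(1) sub] by auto
  ultimately have fin: "\<exists>B. finite B \<and> rep_space ?I = F.span B" by blast
  have vs: "vector_space (rep_scale ?I)"
    unfolding sc by (rule F.vector_space_axioms)
  show ?thesis
  proof (intro fd_representation.intro fd_representation_axioms.intro group_axioms vs)
    show "module.subspace (rep_scale ?I) (rep_space ?I)" unfolding sc by (rule sub)
    show "\<exists>B. finite B \<and> rep_space ?I = module.span (rep_scale ?I) B" unfolding sc by (rule fin)
  next
    fix g f assume "g \<in> carrier G" "f \<in> rep_space ?I"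
    then show "rep_act ?I g f \<in> rep_space ?I"
      by (auto simp: induced_rep_def m_assoc[symmetric])
  next
    fix g f f' assume "g \<in> carrier G" "f \<in> rep_space ?I" "f' \<in> rep_space ?I"
    then show "rep_act ?I g (f + f') = rep_act ?I g f + rep_act ?I g f'"
      by (auto simp: induced_rep_def fun_eq_iff)
  next
    fix g f c assume "g \<in> carrier G" "f \<in> rep_space ?I"
    then show "rep_act ?I g (rep_scale ?I c f) = rep_scale ?I c (rep_act ?I g f)"
      by (auto simp: induced_rep_def fun_eq_iff)
  next
    fix f assume "f \<in> rep_space ?I"
    then show "rep_act ?I \<one> f = f"
      by (auto simp: induced_rep_def fun_eq_iff)
  next
    fix g h f assume "g \<in> carrier G" "h \<in> carrier G" "f \<in> rep_space ?I"
    then show "rep_act ?I (g \<otimes> h) f = rep_act ?I g (rep_act ?I h f)"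
      by (auto simp: induced_rep_def fun_eq_iff inv_mult_group m_assoc)
  qed
qed

end

theory Submission
  imports Defs "HOL-Algebra.Multiplicative_Group"
begin

text \<open>
  Since \<open>Ind\<^sub>U(1)\<close> is the sum of the representations induced from \<open>1\<close>, \<open>\<chi>\<close> and its conjugate,
  an isomorphism \<open>T\<close> from \<open>Ind\<^sub>U(1)\<close> to \<open>Ind\<^sub>U'(1)\<close> restricts to the subspace \<open>Ind\<^sub>H(\<chi>)\<close>, and its image can be
  projected to the three summands of \<open>Ind\<^sub>U'(1)\<close>; comparing degrees shows that \<open>\<chi>'\<close> is cubic too.
  Now \<open>Ind\<^sub>H(\<chi>)\<close> is irreducible, so a nonzero projection to the summand of \<open>\<chi>'\<close> or of its
  conjugate is an isomorphism, all dimensions being equal. Otherwise \<open>T\<close> embeds \<open>Ind\<^sub>H(\<chi>)\<close> into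
  \<open>Ind\<^sub>H'(1)\<close>, which is isomorphic to \<open>Ind\<^sub>H(1)\<close>. That is impossible: an element \<open>e\<close> of \<open>C\<^sub>3\<^sup>n\<close>
  concentrated in the first coordinate acts trivially on \<open>Ind\<^sub>H(1)\<close> but not on \<open>Ind\<^sub>H(\<chi>)\<close>.
\<close>

section \<open>Preliminaries: function spaces, coset representatives, intertwiners\<close>

interpretation complex_fun: vector_space "\<lambda>c (f :: 'a \<Rightarrow> complex) x. c * f x"
  by standard (auto simp: fun_eq_iff algebra_simps)

lemma sum_fun_apply: "(\<Sum>i\<in>A. f i) x = (\<Sum>i\<in>A. f i x)"
  for f :: "'i \<Rightarrow> 'a \<Rightarrow> 'b::comm_monoid_add"
  by (induction A rule: infinite_finite_induct) auto

text \<open>One element is chosen from each left coset, so the count is Lagrange's theorem. The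
  condition \<open>inv r \<otimes> x \<in> H\<close> expresses \<open>x \<in> r <# H\<close> in the
  form in which it meets the support of translated functions below.\<close>

lemma (in group) left_transversal:
  assumes "finite (carrier G)" "subgroup H G"
  obtains R where "R \<subseteq> carrier G" "card R * card H = order G"
    "\<And>x. x \<in> carrier G \<Longrightarrow> \<exists>!r. r \<in> R \<and> inv r \<otimes> x \<in> H"
proof -
  interpret H: subgroup H G by fact
  define rep where "rep C = (SOME x. x \<in> C)" for C :: "'a set"
  have rep: "rep C \<in> C" if C: "C \<in> lcosets H" for C
  proof -
    obtain a where "a \<in> carrier G" "C = a <# H" using C unfolding LCOSETS_def by blast
    then have "a \<in> C" using lcos_self assms by blast
    then show ?thesis unfolding rep_def by (rule someI)
  qed
  have sub: "C \<subseteq> carrier G" if "C \<in> lcosets H" for C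
    using that lcosets_subset_PowG[OF assms(2)] by auto
  have inj: "inj_on rep (lcosets H)"
  proof
    fix C D assume "C \<in> lcosets H" "D \<in> lcosets H" "rep C = rep D"
    then show "C = D" using lcos_disjoint[OF assms(2), of C D] rep[of C] rep[of D] by auto
  qed
  have coset: "C = rep C <# H" if "C \<in> lcosets H" for C
  proof -
    have c: "rep C \<in> carrier G" using rep sub that by auto
    then have "rep C <# H \<in> lcosets H" by (auto simp: LCOSETS_def)
    moreover have "rep C \<in> rep C <# H" using lcos_self c assms by blast
    ultimately show ?thesis using lcos_disjoint[OF assms(2), of C "rep C <# H"] that rep[OF that] by auto
  qed
  have mem: "inv r \<otimes> x \<in> H \<longleftrightarrow> x \<in> r <# H" if "r \<in> carrier G" "x \<in> carrier G" for r x
  proof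
    assume "inv r \<otimes> x \<in> H"
    then show "x \<in> r <# H" unfolding l_coset_def using that
      by (intro UN_I[of "inv r \<otimes> x"]) (auto simp: m_assoc[symmetric])
  next
    assume "x \<in> r <# H"
    then show "inv r \<otimes> x \<in> H" unfolding l_coset_def using that
      by (auto simp: m_assoc[symmetric])
  qed
  show thesis
  proof (rule that[of "rep ` (lcosets H)"])
    show "rep ` (lcosets H) \<subseteq> carrier G" using rep sub by auto
    show "card (rep ` (lcosets H)) * card H = order G"
      using card_image[OF inj] l_lagrange assms by metis
  next
    fix x assume x: "x \<in> carrier G"
    have xc: "x <# H \<in> lcosets H" "x \<in> x <# H"
      using x lcos_self assms by (auto simp: LCOSETS_def)
    show "\<exists>!r. r \<in> rep ` (lcosets H) \<and> inv r \<otimes> x \<in> H"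
    proof (rule ex1I[of _ "rep (x <# H)"])
      show "rep (x <# H) \<in> rep ` (lcosets H) \<and> inv rep (x <# H) \<otimes> x \<in> H"
        using xc mem[OF _ x] coset[OF xc(1)] rep[OF xc(1)] sub[OF xc(1)] by auto
    next
      fix r assume r: "r \<in> rep ` (lcosets H) \<and> inv r \<otimes> x \<in> H"
      then obtain C where C: "C \<in> lcosets H" "r = rep C" by auto
      then have "x \<in> C" using r mem[OF _ x] coset[OF C(1)] rep[OF C(1)] sub[OF C(1)] by auto
      then show "r = rep (x <# H)" using C xc lcos_disjoint[OF assms(2), of C "x <# H"] by auto
    qed
  qed
qed

text \<open>Bijectivity is split off from \<open>rep_isomorphic\<close>, so that restrictions and
  projections can be composed first and tested for injectivity afterwards.\<close>

definition rep_hom ::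
  "('g, 'm) monoid_scheme \<Rightarrow> ('g, 'v::ab_group_add) rep \<Rightarrow> ('g, 'w::ab_group_add) rep \<Rightarrow> ('v \<Rightarrow> 'w) set"
  where "rep_hom G R S = {T. (\<forall>v\<in>rep_space R. T v \<in> rep_space S) \<and>
      (\<forall>v\<in>rep_space R. \<forall>w\<in>rep_space R. T (v + w) = T v + T w) \<and>
      (\<forall>c. \<forall>v\<in>rep_space R. T (rep_scale R c v) = rep_scale S c (T v)) \<and>
      (\<forall>g\<in>carrier G. \<forall>v\<in>rep_space R. T (rep_act R g v) = rep_act S g (T v))}"

lemma rep_isomorphic_iff:
  "rep_isomorphic G R S \<longleftrightarrow> (\<exists>T\<in>rep_hom G R S. bij_betw T (rep_space R) (rep_space S))"
  unfolding rep_isomorphic_def rep_hom_def by (auto simp: bij_betw_def)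

lemma rep_hom_comp:
  "\<lbrakk>S \<in> rep_hom G R1 R2; T \<in> rep_hom G R2 R3\<rbrakk> \<Longrightarrow> T \<circ> S \<in> rep_hom G R1 R3"
  unfolding rep_hom_def by simp

abbreviation ind_char where
  "ind_char G H \<chi> \<equiv> induced_rep G H (character_rep \<chi>)"

section \<open>Representations induced from one-dimensional characters\<close>

locale subgroup_character = group G for G :: "('a, 'm) monoid_scheme" (structure) +
  fixes H and \<chi> :: "'a \<Rightarrow> complex"
  assumes fin: "finite (carrier G)"
    and sub: "subgroup H G"
    and hom: "\<chi> \<in> hom (G\<lparr>carrier := H\<rparr>) complex_units"
begin

sublocale H: subgroup H G by (rule sub)

lemma group_hom_chi: "group_hom (G\<lparr>carrier := H\<rparr>) complex_units \<chi>"
  using H.subgroup_is_group[OF group_axioms] group_complex_units hom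
  by (simp add: group_hom_def group_hom_axioms_def)

lemma chi_nonzero: "h \<in> H \<Longrightarrow> \<chi> h \<noteq> 0"
  using group_hom.hom_closed[OF group_hom_chi, of h] by (simp add: complex_units_def)

lemma chi_mult: "\<lbrakk>h \<in> H; k \<in> H\<rbrakk> \<Longrightarrow> \<chi> (h \<otimes> k) = \<chi> h * \<chi> k"
  using group_hom.hom_mult[OF group_hom_chi, of h k] by (simp add: complex_units_def)

lemma chi_one: "\<chi> \<one> = 1"
  using group_hom.hom_one[OF group_hom_chi] by (simp add: complex_units_def)

lemma chi_inv: "h \<in> H \<Longrightarrow> \<chi> (inv h) = inverse (\<chi> h)"
  using chi_mult[of h "inv h"] chi_one by (intro inverse_unique[symmetric]) simp

abbreviation "V \<equiv> rep_space (ind_char G H \<chi>)"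

abbreviation "act \<equiv> \<lambda>g (f :: 'a \<Rightarrow> complex) x. if x \<in> carrier G then f (inv g \<otimes> x) else 0"

lemma rep_sel:
  "rep_scale (ind_char G H \<chi>) = (\<lambda>c f x. c * f x)"
  "rep_act (ind_char G H \<chi>) = act"
  by (simp_all add: induced_rep_def character_rep_def)

lemma mem_iff: "f \<in> V \<longleftrightarrow>
  (\<forall>x\<in>carrier G. \<forall>h\<in>H. \<chi> h * f (x \<otimes> h) = f x) \<and> (\<forall>x. x \<notin> carrier G \<longrightarrow> f x = 0)"
  by (auto simp: induced_rep_def character_rep_def chi_inv chi_nonzero field_simps)

lemma V_subspace: "complex_fun.subspace V"
  by (auto simp: complex_fun.subspace_def mem_iff distrib_left mult.left_commute)

lemma act_closed:
  assumes "g \<in> carrier G" "f \<in> V" shows "act g f \<in> V"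
proof -
  have "inv g \<otimes> (x \<otimes> h) = inv g \<otimes> x \<otimes> h" if "x \<in> carrier G" "h \<in> H" for x h
    using that assms by (simp add: m_assoc)
  with assms show ?thesis unfolding mem_iff by auto
qed

text \<open>The generator of the induced representation, supported on the trivial coset. The inverse
  is forced by the equivariance in \<open>V\<close>, where right translation by \<open>h\<close>
  multiplies values by the inverse of \<open>\<chi> h\<close>.\<close>

definition delta :: "'a \<Rightarrow> complex" where
  "delta x = (if x \<in> H then \<chi> (inv x) else 0)"

lemma mult_mem_iff: "\<lbrakk>x \<in> carrier G; h \<in> H\<rbrakk> \<Longrightarrow> x \<otimes> h \<in> H \<longleftrightarrow> x \<in> H"
proof
  assume xh: "x \<in> carrier G" "h \<in> H" "x \<otimes> h \<in> H"
  have "x \<otimes> h \<otimes> inv h \<in> H" by (intro H.m_closed[OF xh(3)] H.m_inv_closed xh)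
  moreover have "x \<otimes> h \<otimes> inv h = x" using xh(1) H.mem_carrier[OF xh(2)] by (simp add: m_assoc)
  ultimately show "x \<in> H" by simp
qed auto

lemma delta_mem: "delta \<in> V"
  by (auto simp: mem_iff delta_def mult_mem_iff inv_mult_group chi_mult chi_inv chi_nonzero)

lemma delta_one: "delta \<one> = 1"
  by (simp add: delta_def chi_one)

text \<open>The translates of \<open>delta\<close> along \<open>R\<close> have disjoint supports,
  the left cosets of \<open>H\<close>. At each point a single term survives, and equivariance
  recovers \<open>f x\<close> from the value of \<open>f\<close> at the representative.\<close>

lemma expansion:
  assumes f: "f \<in> V" and R: "R \<subseteq> carrier G"
    "\<And>x. x \<in> carrier G \<Longrightarrow> \<exists>!r. r \<in> R \<and> inv r \<otimes> x \<in> H"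
  shows "f = (\<Sum>r\<in>R. (\<lambda>x. f r * act r delta x))"
proof
  fix x
  show "f x = (\<Sum>r\<in>R. (\<lambda>x. f r * act r delta x)) x"
  proof (cases "x \<in> carrier G")
    case True
    obtain s where s: "s \<in> R" "inv s \<otimes> x \<in> H" and u: "\<And>r. r \<in> R \<Longrightarrow> inv r \<otimes> x \<in> H \<Longrightarrow> r = s"
      using R(2)[OF True] by blast
    have "s \<in> carrier G" using s R by auto
    then have "s \<otimes> (inv s \<otimes> x) = x" using True by (simp add: m_assoc[symmetric])
    \<comment> \<open>Equivariance at the point \<open>s\<close> with the element
      \<open>inv s \<otimes> x\<close> of \<open>H\<close>.\<close>
    then have "f s = \<chi> (inv s \<otimes> x) * f x"
      using f s \<open>s \<in> carrier G\<close> unfolding mem_iff by metis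
    then have "f x = f s * delta (inv s \<otimes> x)"
      using s by (simp add: delta_def chi_inv chi_nonzero)
    also have "\<dots> = (\<Sum>r\<in>{s}. f r * act r delta x)"
      using True by simp
    also have "\<dots> = (\<Sum>r\<in>R. f r * act r delta x)"
    proof (rule sum.mono_neutral_left)
      show "\<forall>r\<in>R - {s}. f r * act r delta x = 0" using u unfolding delta_def by auto
    qed (use s(1) finite_subset[OF R(1) fin] in auto)
    finally show ?thesis by (simp add: sum_fun_apply)
  next
    case False then show ?thesis using f by (simp add: mem_iff sum_fun_apply)
  qed
qed

text \<open>The translates of \<open>delta\<close> along a transversal form a basis: they span by
  \<open>expansion\<close>, and evaluation at the representatives separates them. The dimension is
  recorded as a product to avoid dividing by \<open>card H\<close>.\<close>

lemma basis:
  obtains B where "finite B" "B \<subseteq> V" "complex_fun.independent B" "V \<subseteq> complex_fun.span B"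
    "card B * card H = order G"
proof -
  obtain R where R: "R \<subseteq> carrier G" "card R * card H = order G"
    "\<And>x. x \<in> carrier G \<Longrightarrow> \<exists>!r. r \<in> R \<and> inv r \<otimes> x \<in> H"
    using left_transversal[OF fin sub] by blast
  have finR: "finite R" using R(1) fin finite_subset by blast
  have eval: "act r delta s = (if r = s then 1 else 0)" if "r \<in> R" "s \<in> R" for r s
  proof -
    have rs: "r \<in> carrier G" "s \<in> carrier G" using that R by auto
    have "inv s \<otimes> s \<in> H" using rs by simp
    then have "inv r \<otimes> s \<in> H \<Longrightarrow> r = s" using R(3)[OF rs(2)] that by blast
    then show ?thesis using rs by (auto simp: delta_def chi_one)
  qed
  have inj: "inj_on (\<lambda>r. act r delta) R"
  proof
    fix r s assume rs: "r \<in> R" "s \<in> R" "act r delta = act s delta"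
    then show "r = s" using eval[of r s] eval[of s s] by (metis zero_neq_one)
  qed
  let ?B = "(\<lambda>r. act r delta) ` R"
  have ind: "complex_fun.independent ?B"
  proof (rule complex_fun.independent_if_scalars_zero)
    show "finite ?B" using finR by simp
    fix u b assume s: "(\<Sum>v\<in>?B. (\<lambda>x. u v * v x)) = 0" and b: "b \<in> ?B"
    then obtain s where sR: "s \<in> R" "b = act s delta" by auto
    have "0 = (\<Sum>v\<in>?B. (\<lambda>x. u v * v x)) s" using s by simp
    also have "\<dots> = (\<Sum>v\<in>?B. u v * v s)" by (simp add: sum_fun_apply)
    also have "\<dots> = (\<Sum>r\<in>R. u (act r delta) * act r delta s)"
      by (simp only: sum.reindex[OF inj] o_def)
    also have "\<dots> = (\<Sum>r\<in>R. if r = s then u (act r delta) else 0)"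
      by (intro sum.cong refl) (use eval sR in auto)
    also have "\<dots> = u b" using sR finR by simp
    finally show "u b = 0" by simp
  qed
  show thesis
  proof (rule that[of ?B])
    show "finite ?B" using finR by simp
    show "?B \<subseteq> V" using act_closed delta_mem R(1) by auto
    show "complex_fun.independent ?B" by (rule ind)
    show "V \<subseteq> complex_fun.span ?B"
    proof
      fix f assume f: "f \<in> V"
      have "(\<Sum>r\<in>R. (\<lambda>x. f r * act r delta x)) \<in> complex_fun.span ?B"
        by (intro complex_fun.span_sum complex_fun.span_scale complex_fun.span_base) auto
      then show "f \<in> complex_fun.span ?B" using expansion[OF f R(1,3)] by simp
    qed
    show "card ?B * card H = order G" using R(2) card_image[OF inj] by simp
  qed
qed

text \<open>
  An element \<open>e\<close> as below separates the coset \<open>H\<close> from the others: \<open>act e f - f\<close> is a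
  nonzero multiple of \<open>f\<close> on \<open>H\<close> and vanishes elsewhere. This replaces Mackey's criterion.
\<close>

lemma irreducible:
  assumes e: "e \<in> H" "\<chi> e \<noteq> 1"
    "\<And>x. x \<in> carrier G \<Longrightarrow> inv x \<otimes> e \<otimes> x \<in> H"
    "\<And>x. \<lbrakk>x \<in> carrier G; x \<notin> H\<rbrakk> \<Longrightarrow> \<chi> (inv x \<otimes> e \<otimes> x) = 1"
    and K: "complex_fun.subspace K" "K \<subseteq> V" "\<And>g f. \<lbrakk>g \<in> carrier G; f \<in> K\<rbrakk> \<Longrightarrow> act g f \<in> K"
    and f: "f \<in> K" "f \<noteq> 0"
  shows "K = V"
proof -
  have eG: "e \<in> carrier G" using e(1) by (rule H.mem_carrier)
  obtain y where "f y \<noteq> 0" using f(2) by (auto simp: fun_eq_iff)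
  moreover have "f \<in> V" using f(1) K(2) by blast
  ultimately have y: "y \<in> carrier G" unfolding mem_iff by blast
  \<comment> \<open>Translation moves the point \<open>y\<close>, where \<open>f\<close> does not
    vanish, to the identity: \<open>k \<one> = f y\<close>.\<close>
  define k where "k = act (inv y) f"
  have k: "k \<in> K" "k \<one> \<noteq> 0" using K(3) f(1) y \<open>f y \<noteq> 0\<close> by (auto simp: k_def)
  then have kV: "k \<in> V" using K(2) by auto
  define d where "d = (\<lambda>x. act e k x - k x)"
  have "d = act e k - k" by (auto simp: d_def fun_eq_iff)
  then have "d \<in> K" using complex_fun.subspace_diff[OF K(1)] K(3)[OF eG k(1)] k(1) by metis
  moreover have "d = (\<lambda>x. ((\<chi> e - 1) * k \<one>) * delta x)"
  proof
    fix x
    show "d x = ((\<chi> e - 1) * k \<one>) * delta x"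
    proof (cases "x \<in> carrier G")
      case x: True
      let ?c = "inv x \<otimes> e \<otimes> x"
      \<comment> \<open>The left factor \<open>inv e\<close> is traded for a right factor:
        \<open>inv e \<otimes> x\<close> times the conjugate \<open>?c\<close> is \<open>x\<close>,
        so equivariance makes \<open>act e k x\<close> equal to
        \<open>\<chi> ?c * k x\<close>.\<close>
      have "k (inv e \<otimes> x) = \<chi> ?c * k (inv e \<otimes> x \<otimes> ?c)"
        using kV x eG e(3)[OF x] by (simp add: mem_iff)
      also have "inv e \<otimes> x \<otimes> ?c = x"
      proof -
        have "x \<otimes> ?c = e \<otimes> x" using x eG by (simp add: m_assoc[symmetric])
        moreover have "inv e \<otimes> x \<otimes> ?c = inv e \<otimes> (x \<otimes> ?c)" using x eG by (intro m_assoc) auto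
        ultimately show ?thesis using x eG by (simp add: m_assoc[symmetric])
      qed
      finally have dx: "d x = (\<chi> ?c - 1) * k x" using x by (simp add: d_def algebra_simps)
      show ?thesis
      proof (cases "x \<in> H")
        case True
        \<comment> \<open>For \<open>x\<close> in \<open>H\<close> the conjugation happens inside
          \<open>H\<close>, where \<open>\<chi>\<close> does not see it because its values
          commute.\<close>
        have "\<chi> ?c = \<chi> e" using True e(1) by (simp add: chi_mult chi_inv chi_nonzero)
        moreover have "k \<one> = \<chi> x * k x" using kV True x by (metis l_one mem_iff one_closed)
        ultimately show ?thesis using True dx by (simp add: delta_def chi_inv chi_nonzero)
      next
        case False then show ?thesis using dx e(4) x by (simp add: delta_def)
      qed
    next
      case False
      then show ?thesis using kV by (auto simp: d_def delta_def mem_iff)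
    qed
  qed
  ultimately have "(\<lambda>x. ((\<chi> e - 1) * k \<one>) * delta x) \<in> K" by simp
  note complex_fun.subspace_scale[OF K(1) this, of "inverse ((\<chi> e - 1) * k \<one>)"]
  moreover have "(\<lambda>x. inverse ((\<chi> e - 1) * k \<one>) * (((\<chi> e - 1) * k \<one>) * delta x)) = delta"
    using e(2) k(2) by (auto simp: fun_eq_iff field_simps)
  ultimately have delta: "delta \<in> K" by simp
  \<comment> \<open>Once \<open>delta\<close> lies in \<open>K\<close>, so do its translates, and
    these span \<open>V\<close> by \<open>expansion\<close>.\<close>
  obtain R where R: "R \<subseteq> carrier G" "card R * card H = order G"
    "\<And>x. x \<in> carrier G \<Longrightarrow> \<exists>!r. r \<in> R \<and> inv r \<otimes> x \<in> H"
    using left_transversal[OF fin sub] by blast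
  have "v \<in> K" if "v \<in> V" for v
  proof -
    have "(\<Sum>r\<in>R. (\<lambda>x. v r * act r delta x)) \<in> K"
      by (intro complex_fun.subspace_sum[OF K(1)] complex_fun.subspace_scale[OF K(1)] K(3) delta)
        (use R(1) in auto)
    then show ?thesis using expansion[OF that R(1,3)] by simp
  qed
  then show ?thesis using K(2) by auto
qed

end

section \<open>Kernel and image of a character\<close>

context subgroup_character
begin

lemma kernel_subgroup: "subgroup {h \<in> H. \<chi> h = 1} G"
  by (intro subgroupI) (auto simp: chi_inv chi_mult chi_one intro: exI[of _ \<one>])

text \<open>Every fibre of \<open>\<chi>\<close> over its image is a translate of the
  kernel.\<close>

lemma card_eq_kernel_image: "card H = card {h \<in> H. \<chi> h = 1} * card (\<chi> ` H)"
proof -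
  have finH: "finite H" using H.subset fin finite_subset by blast
  have fibre: "card {h \<in> H. \<chi> h = z} = card {h \<in> H. \<chi> h = 1}" if z: "z \<in> \<chi> ` H" for z
  proof -
    obtain k where k: "k \<in> H" "z = \<chi> k" using z by blast
    have kG: "k \<in> carrier G" using k(1) by (rule H.mem_carrier)
    have "bij_betw (\<lambda>h. k \<otimes> h) {h \<in> H. \<chi> h = 1} {h \<in> H. \<chi> h = z}"
    proof (rule bij_betw_byWitness[where f' = "\<lambda>h. inv k \<otimes> h"])
      show "\<forall>h\<in>{h \<in> H. \<chi> h = 1}. inv k \<otimes> (k \<otimes> h) = h"
        using kG H.mem_carrier by (auto simp: m_assoc[symmetric])
      show "\<forall>h\<in>{h \<in> H. \<chi> h = z}. k \<otimes> (inv k \<otimes> h) = h"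
        using kG H.mem_carrier by (auto simp: m_assoc[symmetric])
    qed (use k in \<open>auto simp: chi_mult chi_inv chi_nonzero\<close>)
    from bij_betw_same_card[OF this] show ?thesis by (rule sym)
  qed
  have "card H = (\<Sum>z\<in>\<chi> ` H. card {h \<in> H. \<chi> h = z})"
    using sum.image_gen[OF finH, of "\<lambda>_. 1 :: nat" \<chi>] by simp
  also have "\<dots> = card {h \<in> H. \<chi> h = 1} * card (\<chi> ` H)"
    using fibre by simp
  finally show ?thesis .
qed

lemma chi_power_card_image:
  assumes "h \<in> H" shows "\<chi> h ^ card (\<chi> ` H) = 1"
proof -
  let ?I = "complex_units\<lparr>carrier := \<chi> ` H\<rparr>"
  have "subgroup (\<chi> ` H) complex_units" using group_hom.img_is_subgroup[OF group_hom_chi] by simp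
  then interpret I: group ?I
    by (rule subgroup.subgroup_is_group[OF _ group_complex_units])
  have pow: "z [^]\<^bsub>?I\<^esub> k = z ^ k" for z and k :: nat
    by (induction k) (simp_all add: complex_units_def)
  show ?thesis
    using I.pow_order_eq_1[of "\<chi> h"] assms unfolding pow by (simp add: order_def complex_units_def)
qed

end

lemma subgroup_character_trivial:
  assumes "group G" "finite (carrier G)" "subgroup H G"
  shows "subgroup_character G H (\<lambda>_. 1)"
  using assms by (auto simp: subgroup_character_def subgroup_character_axioms_def
      hom_def complex_units_def)

section \<open>Intertwiners between two induced characters\<close>

locale induced_hom =
  A: subgroup_character G H \<chi> + B: subgroup_character G K \<psi>
  for G :: "('a, 'm) monoid_scheme" (structure) and H \<chi> K \<psi> +
  fixes T
  assumes T: "T \<in> rep_hom G (ind_char G H \<chi>) (ind_char G K \<psi>)"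
begin

lemma T_mem: "f \<in> A.V \<Longrightarrow> T f \<in> B.V"
  and T_add: "\<lbrakk>f \<in> A.V; f' \<in> A.V\<rbrakk> \<Longrightarrow> T (f + f') = T f + T f'"
  and T_scale: "f \<in> A.V \<Longrightarrow> T (\<lambda>x. c * f x) = (\<lambda>x. c * T f x)"
  and T_act: "\<lbrakk>g \<in> carrier G; f \<in> A.V\<rbrakk> \<Longrightarrow> T (A.act g f) = A.act g (T f)"
  using T unfolding rep_hom_def by (auto simp: A.rep_sel B.rep_sel)

lemma T_zero: "T 0 = 0"
  using T_add[of 0 0] complex_fun.subspace_0[OF A.V_subspace] by simp

lemma T_diff:
  assumes "f \<in> A.V" "f' \<in> A.V" shows "T (f - f') = T f - T f'"
  using T_add[of "f - f'" f'] complex_fun.subspace_diff[OF A.V_subspace] assms by simp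

lemma T_sum:
  assumes "S \<subseteq> A.V"
  shows "T (\<Sum>b\<in>S. (\<lambda>x. c b * b x)) = (\<Sum>b\<in>S. (\<lambda>x. c b * T b x))"
  using assms
proof (induction S rule: infinite_finite_induct)
  case (insert b S)
  have "(\<Sum>b\<in>S. (\<lambda>x. c b * b x)) \<in> A.V"
    by (intro complex_fun.subspace_sum[OF A.V_subspace] complex_fun.subspace_scale[OF A.V_subspace])
      (use insert.prems in auto)
  moreover have "(\<lambda>x. c b * b x) \<in> A.V"
    using insert.prems by (intro complex_fun.subspace_scale[OF A.V_subspace]) auto
  ultimately show ?case
    using insert by (simp only: sum.insert T_add T_scale insert_subset simp_thms)
qed (simp_all add: T_zero)

lemma kernel_subspace: "complex_fun.subspace {f \<in> A.V. T f = 0}"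
  using A.V_subspace by (auto simp: complex_fun.subspace_def T_zero T_add T_scale)

lemma image_subspace: "complex_fun.subspace (T ` A.V)"
  unfolding complex_fun.subspace_def
proof (intro conjI ballI allI)
  show "0 \<in> T ` A.V"
    using T_zero complex_fun.subspace_0[OF A.V_subspace] by (metis imageI)
next
  fix f f' assume "f \<in> T ` A.V" "f' \<in> T ` A.V"
  then obtain v v' where "v \<in> A.V" "v' \<in> A.V" "f = T v" "f' = T v'" by blast
  then show "f + f' \<in> T ` A.V"
    using T_add complex_fun.subspace_add[OF A.V_subspace] by (metis imageI)
next
  fix c f assume "f \<in> T ` A.V"
  then obtain v where "v \<in> A.V" "f = T v" by blast
  then show "(\<lambda>x. c * f x) \<in> T ` A.V"
    using T_scale complex_fun.subspace_scale[OF A.V_subspace] by (metis imageI)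
qed

lemma injI:
  assumes "\<And>f. \<lbrakk>f \<in> A.V; T f = 0\<rbrakk> \<Longrightarrow> f = 0"
  shows "inj_on T A.V"
proof
  fix f f' assume f: "f \<in> A.V" "f' \<in> A.V" "T f = T f'"
  have "T (f - f') = 0" using T_diff[OF f(1,2)] f(3) by simp
  with complex_fun.subspace_diff[OF A.V_subspace f(1,2)] have "f - f' = 0" by (rule assms)
  then show "f = f'" by simp
qed

text \<open>An injective \<open>T\<close> keeps a basis independent, so the dimension cannot drop.
  By \<open>basis\<close> the dimensions are the indices of \<open>H\<close> and \<open>K\<close>,
  which reverses the inequality between the orders.\<close>

lemma
  assumes inj: "inj_on T A.V"
  shows injective_card_le: "card K \<le> card H"
    and injective_bij: "card K = card H \<Longrightarrow> bij_betw T A.V B.V"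
proof -
  obtain B where B: "finite B" "B \<subseteq> A.V" "complex_fun.independent B"
    "card B * card H = order G"
    using A.basis by metis
  obtain C where C: "finite C" "B.V \<subseteq> complex_fun.span C" "card C * card K = order G"
    using B.basis by metis
  have injB: "inj_on T B" using inj B(2) by (rule inj_on_subset)
  have ind: "complex_fun.independent (T ` B)"
  proof (rule complex_fun.independent_if_scalars_zero)
    show "finite (T ` B)" using B(1) by simp
    fix u v assume 0: "(\<Sum>v\<in>T ` B. (\<lambda>x. u v * v x)) = 0" and v: "v \<in> T ` B"
    obtain b where b: "b \<in> B" "v = T b" using v by blast
    let ?s = "\<Sum>b\<in>B. (\<lambda>x. u (T b) * b x)"
    have "T ?s = (\<Sum>b\<in>B. (\<lambda>x. u (T b) * T b x))"
      using T_sum[OF B(2), of "\<lambda>b. u (T b)"] .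
    also have "\<dots> = 0" using 0 by (simp add: sum.reindex[OF injB] o_def)
    finally have "T ?s = T 0" by (simp add: T_zero)
    moreover have "?s \<in> A.V"
      by (intro complex_fun.subspace_sum[OF A.V_subspace] complex_fun.subspace_scale[OF A.V_subspace])
        (use B(2) in auto)
    ultimately have "?s = 0"
      using inj_onD[OF inj] complex_fun.subspace_0[OF A.V_subspace] by blast
    then show "u v = 0"
      using complex_fun.independentD[OF B(3) B(1) order_refl, of "\<lambda>b. u (T b)"] b by blast
  qed
  have TB: "T ` B \<subseteq> B.V" using T_mem B(2) by auto
  have "H \<noteq> {}" "carrier G \<noteq> {}" using A.H.one_closed A.one_closed by blast+
  then have pos: "card H > 0" "order G > 0"
    using A.fin finite_subset[OF A.H.subset A.fin] by (auto simp: card_gt_0_iff order_def)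
  have "card (T ` B) \<le> card C"
    using complex_fun.independent_span_bound[OF C(1) ind] TB C(2) by auto
  then have le: "card B \<le> card C" by (simp add: card_image[OF injB])
  show "card K \<le> card H"
  proof (rule ccontr)
    assume "\<not> card K \<le> card H"
    then have "card B * card H < card C * card K"
      using le pos B(4) by (intro mult_le_less_imp_less) (auto intro!: Nat.gr0I)
    then show False using B(4) C(3) by simp
  qed
  assume eq: "card K = card H"
  then have eq': "card B = card C" using B(4) C(3) pos(1) by (metis mult_right_cancel nat_less_le)
  have "y \<in> T ` A.V" if y: "y \<in> B.V" for y
  proof -
    \<comment> \<open>If \<open>y\<close> were outside the span, adding it would give
      \<open>card C + 1\<close> independent vectors in a space spanned by \<open>C\<close>.\<close>
    have "y \<in> complex_fun.span (T ` B)"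
    proof (rule ccontr)
      assume n: "y \<notin> complex_fun.span (T ` B)"
      then have "complex_fun.independent (insert y (T ` B))"
        using ind by (rule complex_fun.independent_insertI)
      then have "card (insert y (T ` B)) \<le> card C"
        using complex_fun.independent_span_bound[OF C(1)] TB C(2) y by blast
      moreover have "y \<notin> T ` B" using n complex_fun.span_base by blast
      ultimately show False using B(1) eq' by (simp add: card_image[OF injB])
    qed
    also have "complex_fun.span (T ` B) \<subseteq> T ` A.V"
      using B(2) image_subspace by (intro complex_fun.span_minimal) auto
    finally show ?thesis .
  qed
  then show "bij_betw T A.V B.V" using inj T_mem unfolding bij_betw_def by blast
qed

lemma inverse_hom:
  assumes bij: "bij_betw T A.V B.V"
  shows "inv_into A.V T \<in> rep_hom G (ind_char G K \<psi>) (ind_char G H \<chi>)"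
proof -
  let ?S = "inv_into A.V T"
  have S: "?S w \<in> A.V" "T (?S w) = w" if "w \<in> B.V" for w
    using bij that by (auto simp: bij_betw_def inv_into_into f_inv_into_f)
  have SI: "?S w = v" if "v \<in> A.V" "T v = w" for v w
    using bij that inv_into_f_f bij_betw_def by metis
  show ?thesis
    unfolding rep_hom_def mem_Collect_eq A.rep_sel B.rep_sel
  proof (intro conjI ballI allI)
    fix v w assume "v \<in> B.V" "w \<in> B.V"
    then show "?S (v + w) = ?S v + ?S w"
      by (intro SI) (simp_all only: S T_add complex_fun.subspace_add[OF A.V_subspace])
  next
    fix c v assume "v \<in> B.V"
    then show "?S (\<lambda>x. c * v x) = (\<lambda>x. c * ?S v x)"
      by (intro SI) (simp_all only: S T_scale complex_fun.subspace_scale[OF A.V_subspace])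
  next
    fix g v assume "g \<in> carrier G" "v \<in> B.V"
    then show "?S (A.act g v) = A.act g (?S v)"
      by (intro SI) (simp_all only: S A.act_closed T_act)
  qed (use S in auto)
qed

text \<open>\<open>injective_card_le\<close> applies to \<open>T\<close> and to its inverse. Through
  this lemma both isomorphism hypotheses yield equal orders of subgroups.\<close>

lemma bij_card_eq:
  assumes "bij_betw T A.V B.V" shows "card K = card H"
proof -
  interpret I: induced_hom G K \<psi> H \<chi> "inv_into A.V T"
    by unfold_locales (rule inverse_hom[OF assms])
  have "card K \<le> card H" "card H \<le> card K"
    using assms bij_betw_inv_into[OF assms]
    by (auto simp: bij_betw_def intro: injective_card_le I.injective_card_le)
  then show ?thesis by simp
qed

text \<open>The properties of \<open>e\<close> make the source irreducible, so a nonzero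
  \<open>T\<close> has trivial kernel. Surjectivity comes from equality of dimensions, not from
  irreducibility of the target.\<close>

lemma schur:
  assumes e: "e \<in> H" "\<chi> e \<noteq> 1"
    "\<And>x. x \<in> carrier G \<Longrightarrow> inv x \<otimes> e \<otimes> x \<in> H"
    "\<And>x. \<lbrakk>x \<in> carrier G; x \<notin> H\<rbrakk> \<Longrightarrow> \<chi> (inv x \<otimes> e \<otimes> x) = 1"
    and f: "f \<in> A.V" "T f \<noteq> 0"
    and card: "card K = card H"
  shows "rep_isomorphic G (ind_char G H \<chi>) (ind_char G K \<psi>)"
proof -
  have "inj_on T A.V"
  proof (rule injI, rule ccontr)
    fix k assume k: "k \<in> A.V" "T k = 0" "k \<noteq> 0"
    have "{f \<in> A.V. T f = 0} = A.V"
    proof (rule A.irreducible[OF e kernel_subspace])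
      fix g f assume "g \<in> carrier G" "f \<in> {f \<in> A.V. T f = 0}"
      then show "A.act g f \<in> {f \<in> A.V. T f = 0}"
        using A.act_closed by (auto simp: T_act fun_eq_iff)
    qed (use k in auto)
    then show False using f by blast
  qed
  then show ?thesis using injective_bij[OF _ card] T unfolding rep_isomorphic_iff by blast
qed

end

section \<open>Averaging against a character\<close>

definition char_average ::
  "('g, 'm) monoid_scheme \<Rightarrow> 'g set \<Rightarrow> ('g \<Rightarrow> complex) \<Rightarrow> ('g \<Rightarrow> complex) \<Rightarrow> ('g \<Rightarrow> complex)"
  where "char_average G K \<psi> f x =
    (if x \<in> carrier G then \<Sum>k\<in>K. \<psi> k * f (x \<otimes>\<^bsub>G\<^esub> k) else 0)"

text \<open>Right translation by \<open>h\<close> only reindexes the sum over \<open>H\<close>. On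
  \<open>V\<close> itself the average is multiplication by \<open>card H\<close>, so this is the
  projection to \<open>V\<close> up to a nonzero scalar, which does not affect whether a value
  vanishes.\<close>

lemma (in subgroup_character) char_average_mem: "char_average G H \<chi> f \<in> V"
  unfolding mem_iff
proof (intro conjI ballI allI impI)
  fix x h assume xh: "x \<in> carrier G" "h \<in> H"
  have hG: "h \<in> carrier G" using xh(2) by (rule H.mem_carrier)
  have "\<chi> h * char_average G H \<chi> f (x \<otimes> h) = (\<Sum>k\<in>H. \<chi> (h \<otimes> k) * f (x \<otimes> (h \<otimes> k)))"
    using xh hG H.mem_carrier
    by (auto simp: char_average_def sum_distrib_left chi_mult m_assoc mult.assoc intro!: sum.cong)
  also have "\<dots> = (\<Sum>k\<in>H. \<chi> k * f (x \<otimes> k))"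
  proof (rule sum.reindex_bij_witness[of _ "\<lambda>k. inv h \<otimes> k" "\<lambda>k. h \<otimes> k"])
    fix k assume k: "k \<in> H"
    have kG: "k \<in> carrier G" using k by (rule H.mem_carrier)
    show "inv h \<otimes> (h \<otimes> k) = k" "h \<otimes> (inv h \<otimes> k) = k"
      using kG hG by (simp_all add: m_assoc[symmetric])
    show "h \<otimes> k \<in> H" "inv h \<otimes> k \<in> H" using xh k by auto
  qed simp
  finally show "\<chi> h * char_average G H \<chi> f (x \<otimes> h) = char_average G H \<chi> f x"
    using xh by (simp add: char_average_def)
qed (simp add: char_average_def)

text \<open>The average is built from right translations, while the group acts by left translations;
  the two commute.\<close>

lemma char_average_hom:
  assumes A: "subgroup_character G U \<phi>" and B: "subgroup_character G K \<psi>"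
  shows "char_average G K \<psi> \<in> rep_hom G (ind_char G U \<phi>) (ind_char G K \<psi>)"
proof -
  interpret A: subgroup_character G U \<phi> by fact
  interpret B: subgroup_character G K \<psi> by fact
  show ?thesis
    unfolding rep_hom_def mem_Collect_eq A.rep_sel B.rep_sel
  proof (intro conjI ballI allI)
    fix g f assume g: "g \<in> carrier G"
    show "char_average G K \<psi> (A.act g f) = A.act g (char_average G K \<psi> f)"
      using g B.H.mem_carrier
      by (auto simp: char_average_def fun_eq_iff A.m_assoc intro!: sum.cong)
  qed (auto simp: B.char_average_mem char_average_def fun_eq_iff distrib_left sum.distrib
      sum_distrib_left mult.left_commute)
qed

section \<open>The criterion for cubic characters\<close>

lemma cube_root_of_unity_sum:
  fixes z :: complex assumes "z ^ 3 = 1"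
  shows "1 + z + cnj z = (if z = 1 then 3 else 0)"
proof -
  have "norm z ^ 3 = 1" using assms by (metis norm_one norm_power)
  then have "norm z = 1" using power_eq_1_iff[of "norm z" 3] by simp
  then have "z * cnj z = 1" by (simp add: complex_norm_square[symmetric])
  then have "cnj z = z ^ 3 * cnj z" using assms by simp
  also have "\<dots> = z\<^sup>2 * (z * cnj z)" by (simp add: power2_eq_square power3_eq_cube)
  \<comment> \<open>Conjugation is squaring on cube roots of unity, so the sum is the cofactor of
    \<open>z - 1\<close> in \<open>z ^ 3 - 1\<close>.\<close>
  finally have c: "cnj z = z\<^sup>2" using \<open>z * cnj z = 1\<close> by simp
  have "(z - 1) * (1 + z + z\<^sup>2) = z ^ 3 - 1"
    by (simp add: algebra_simps power2_eq_square power3_eq_cube)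
  then show ?thesis using assms c by auto
qed

text \<open>The semidirect product enters only through \<open>e\<close>: all its conjugates lie in
  \<open>H\<close>, and \<open>\<chi>\<close> is trivial on those by elements outside
  \<open>H\<close>. These properties give irreducibility and also distinguish the source from a
  subrepresentation of the one induced from the trivial character.\<close>

theorem induced_cubic_characters_isomorphic:
  fixes G (structure)
  assumes A: "subgroup_character G H \<chi>" and B: "subgroup_character G H' \<chi>'"
    and cubic: "\<chi> ` H = {z. z ^ 3 = 1}"
    and e: "e \<in> H" "\<chi> e \<noteq> 1"
      "\<And>x. x \<in> carrier G \<Longrightarrow> inv x \<otimes> e \<otimes> x \<in> H"
      "\<And>x. \<lbrakk>x \<in> carrier G; x \<notin> H\<rbrakk> \<Longrightarrow> \<chi> (inv x \<otimes> e \<otimes> x) = 1"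
    and iso: "rep_isomorphic G (induced_rep G H trivial_rep) (induced_rep G H' trivial_rep)"
    and iso_ker: "rep_isomorphic G (induced_rep G {h \<in> H. \<chi> h = 1} trivial_rep)
      (induced_rep G {h \<in> H'. \<chi>' h = 1} trivial_rep)"
  shows "rep_isomorphic G (ind_char G H \<chi>) (ind_char G H' \<chi>') \<or>
    rep_isomorphic G (ind_char G H \<chi>) (ind_char G H' (\<lambda>x. cnj (\<chi>' x)))"
proof -
  interpret A: subgroup_character G H \<chi> by fact
  interpret B: subgroup_character G H' \<chi>' by fact
  define U where "U = {h \<in> H. \<chi> h = 1}"
  define U' where "U' = {h \<in> H'. \<chi>' h = 1}"
  have triv: "subgroup_character G L (\<lambda>_. 1)" if "subgroup L G" for L
    using that A.group_axioms A.fin by (intro subgroup_character_trivial)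
  interpret A1: subgroup_character G H "\<lambda>_. 1" by (rule triv[OF A.sub])
  interpret B1: subgroup_character G H' "\<lambda>_. 1" by (rule triv[OF B.sub])
  have sU: "subgroup U G" and sU': "subgroup U' G"
    unfolding U_def U'_def by (rule A.kernel_subgroup B.kernel_subgroup)+
  interpret UA: subgroup_character G U "\<lambda>_. 1" by (rule triv[OF sU])
  interpret UB: subgroup_character G U' "\<lambda>_. 1" by (rule triv[OF sU'])
  have "(\<lambda>x. cnj (\<chi>' x)) \<in> hom (G\<lparr>carrier := H'\<rparr>) complex_units"
    using B.chi_nonzero B.chi_mult by (auto simp: hom_def complex_units_def)
  then interpret BC: subgroup_character G H' "\<lambda>x. cnj (\<chi>' x)"
    using A.fin B.sub by unfold_locales
  obtain Q where Q: "Q \<in> rep_hom G (ind_char G H (\<lambda>_. 1)) (ind_char G H' (\<lambda>_. 1))"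
    "bij_betw Q A1.V B1.V"
    using iso unfolding rep_isomorphic_iff trivial_rep_def by blast
  interpret Q: induced_hom G H "\<lambda>_. 1" H' "\<lambda>_. 1" Q
    using Q(1) by unfold_locales
  obtain T where T: "T \<in> rep_hom G (ind_char G U (\<lambda>_. 1)) (ind_char G U' (\<lambda>_. 1))"
    "bij_betw T UA.V UB.V"
    using iso_ker unfolding rep_isomorphic_iff trivial_rep_def U_def U'_def by blast
  interpret T: induced_hom G U "\<lambda>_. 1" U' "\<lambda>_. 1" T
    using T(1) by unfold_locales
  have card_H: "card H' = card H" by (rule Q.bij_card_eq[OF Q(2)])
  have card_U: "card U' = card U" by (rule T.bij_card_eq[OF T(2)])
  have "U \<noteq> {}" using UA.H.one_closed by blast
  then have pos: "card U > 0"
    using finite_subset[OF UA.H.subset A.fin] by (simp add: card_gt_0_iff)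
  \<comment> \<open>Equal orders of the subgroups and of the kernels force images of equal size,
    hence three values of \<open>\<chi>'\<close>.\<close>
  have "card U * card (\<chi>' ` H') = card U * card (\<chi> ` H)"
    using A.card_eq_kernel_image B.card_eq_kernel_image card_H card_U
    unfolding U_def[symmetric] U'_def[symmetric] by metis
  then have "card (\<chi>' ` H') = card (\<chi> ` H)" using pos by simp
  then have "card (\<chi>' ` H') = 3" unfolding cubic by (simp add: card_roots_unity_eq)
  then have cube: "\<chi>' h ^ 3 = 1" if "h \<in> H'" for h
    using B.chi_power_card_image[OF that] by simp
  \<comment> \<open>Functions equivariant under \<open>\<chi>\<close> are invariant under its
    kernel, so \<open>T\<close> restricts to \<open>A.V\<close>.\<close>
  have VU: "A.V \<subseteq> UA.V"
  proof
    fix f assume f: "f \<in> A.V"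
    have "1 * f (x \<otimes> h) = f x" if x: "x \<in> carrier G" and h: "h \<in> U" for x h
    proof -
      have "h \<in> H" "\<chi> h = 1" using h by (simp_all add: U_def)
      then show ?thesis using f x unfolding A.mem_iff by metis
    qed
    then show "f \<in> UA.V" using f unfolding A.mem_iff UA.mem_iff by blast
  qed
  have T': "T \<in> rep_hom G (ind_char G H \<chi>) (ind_char G U' (\<lambda>_. 1))"
    using T(1) VU unfolding rep_hom_def mem_Collect_eq A.rep_sel UA.rep_sel by blast
  let ?P = "\<lambda>\<psi>. char_average G H' \<psi> \<circ> T"
  have P: "induced_hom G H \<chi> H' \<psi> (?P \<psi>)" if "subgroup_character G H' \<psi>" for \<psi>
    using A that rep_hom_comp[OF T' char_average_hom[OF UB.subgroup_character_axioms that]]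
    by (simp add: induced_hom_def induced_hom_axioms_def)
  have schur: "rep_isomorphic G (ind_char G H \<chi>) (ind_char G H' \<psi>)"
    if "subgroup_character G H' \<psi>" "f \<in> A.V" "?P \<psi> f \<noteq> 0" for \<psi> f
    by (rule induced_hom.schur[OF P[OF that(1)] e that(2,3) card_H])
  show ?thesis
  proof (rule ccontr)
    assume neg: "\<not> ?thesis"
    interpret M: induced_hom G H \<chi> H' "\<lambda>_. 1" "?P (\<lambda>_. 1)"
      by (rule P[OF B1.subgroup_character_axioms])
    \<comment> \<open>The projections for \<open>\<chi>'\<close> and its conjugate vanish by
      \<open>neg\<close>, so adding them to the trivial one changes nothing. The three characters
      sum to three times the indicator of \<open>U'\<close>, under which \<open>T f\<close> is right
      invariant; thus the trivial projection of \<open>T f\<close> is a nonzero multiple of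
      \<open>T f\<close>.\<close>
    have M: "?P (\<lambda>_. 1) f = (\<lambda>x. 3 * of_nat (card U') * T f x)" if f: "f \<in> A.V" for f
    proof
      fix x
      have TV: "T f \<in> UB.V" using T.T_mem f VU by blast
      have z: "?P \<chi>' f = 0" "?P (\<lambda>x. cnj (\<chi>' x)) f = 0"
        using schur[OF B f] schur[OF BC.subgroup_character_axioms f] neg by blast+
      show "?P (\<lambda>_. 1) f x = 3 * of_nat (card U') * T f x"
      proof (cases "x \<in> carrier G")
        case True
        have "?P (\<lambda>_. 1) f x = ?P (\<lambda>_. 1) f x + ?P \<chi>' f x + ?P (\<lambda>x. cnj (\<chi>' x)) f x"
          by (simp only: z zero_fun_def add_0_right)
        also have "\<dots> = (\<Sum>k\<in>H'. (1 + \<chi>' k + cnj (\<chi>' k)) * T f (x \<otimes> k))"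
          using True by (simp add: char_average_def sum.distrib algebra_simps)
        also have "\<dots> = (\<Sum>k\<in>H'. if k \<in> U' then 3 * T f x else 0)"
        proof (rule sum.cong[OF refl])
          fix k assume k: "k \<in> H'"
          have "T f (x \<otimes> k) = T f x" if "k \<in> U'"
            using TV True that unfolding UB.mem_iff by (metis mult_1)
          then show "(1 + \<chi>' k + cnj (\<chi>' k)) * T f (x \<otimes> k) = (if k \<in> U' then 3 * T f x else 0)"
            using cube_root_of_unity_sum[OF cube[OF k]] k by (auto simp: U'_def)
        qed
        also have "\<dots> = (\<Sum>k\<in>U'. 3 * T f x)"
          using finite_subset[OF B.H.subset A.fin]
          by (intro sum.mono_neutral_cong_right) (auto simp: U'_def)
        finally show ?thesis by simp
      next
        case False
        then show ?thesis using TV unfolding UB.mem_iff by (simp add: char_average_def)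
      qed
    qed
    have eG: "e \<in> carrier G" using e(1) by (rule A.H.mem_carrier)
    \<comment> \<open>Left translation by \<open>inv e\<close> at \<open>x\<close> is right
      translation by a conjugate of \<open>inv e\<close>, which lies in \<open>H\<close>.\<close>
    have fixed: "A.act e q = q" if q: "q \<in> A1.V" for q
    proof
      fix x
      show "A.act e q x = q x"
      proof (cases "x \<in> carrier G")
        case True
        have "inv x \<otimes> inv e \<otimes> x = inv (inv x \<otimes> e \<otimes> x)"
          using True eG by (simp add: A.inv_mult_group A.m_assoc)
        then have "inv x \<otimes> inv e \<otimes> x \<in> H" using e(3)[OF True] by simp
        then have "q (x \<otimes> (inv x \<otimes> inv e \<otimes> x)) = q x"
          using q True unfolding A1.mem_iff by (metis mult_1)
        moreover have "x \<otimes> (inv x \<otimes> inv e \<otimes> x) = inv e \<otimes> x"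
          using True eG by (simp add: A.m_assoc[symmetric])
        ultimately show ?thesis using True by simp
      next
        case False then show ?thesis using q by (simp add: A1.mem_iff)
      qed
    qed
    have d: "A.act e A.delta \<in> A.V" using A.act_closed[OF eG A.delta_mem] .
    have "?P (\<lambda>_. 1) A.delta \<in> B1.V" using M.T_mem[OF A.delta_mem] .
    \<comment> \<open>The bijection \<open>Q\<close> carries the trivial action of \<open>e\<close>
      on \<open>A1.V\<close> over to \<open>B1.V\<close>, where the projection of
      \<open>T A.delta\<close> lives.\<close>
    then obtain q where q: "q \<in> A1.V" "?P (\<lambda>_. 1) A.delta = Q q"
      using Q(2) by (auto simp: bij_betw_def)
    have "?P (\<lambda>_. 1) (A.act e A.delta) = A.act e (Q q)"
      unfolding q(2)[symmetric] by (rule M.T_act[OF eG A.delta_mem])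
    also have "\<dots> = Q q" unfolding Q.T_act[OF eG q(1), symmetric] fixed[OF q(1)] ..
    finally have "?P (\<lambda>_. 1) (A.act e A.delta) = ?P (\<lambda>_. 1) A.delta" by (simp only: q(2))
    then have "T (A.act e A.delta) = T A.delta"
      unfolding M[OF d] M[OF A.delta_mem] using pos card_U by (simp add: fun_eq_iff)
    then have "A.act e A.delta = A.delta"
      using T(2) d A.delta_mem VU unfolding bij_betw_def by (meson inj_onD subsetD)
    \<comment> \<open>At the identity the translate of \<open>A.delta\<close> takes the value
      \<open>\<chi> e\<close>, while \<open>A.delta\<close> takes the value 1.\<close>
    from fun_cong[OF this, of \<one>] have "A.delta (inv e) = 1"
      using eG by (simp add: A.delta_one)
    then show False using e(1,2) eG by (simp add: A.delta_def)
  qed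
qed

section \<open>Conjugation of the first coordinate axis in the semidirect product\<close>

lemma (in coset_setup) one_in_index: "1 \<in> {1..n}"
proof -
  have "H \<in> lcosets H"
    using lcos_mult_one[OF H_subset] unfolding LCOSETS_def by force
  then show ?thesis using bij_betw_imp_surj_on[OF X_bij] by (cases n) auto
qed

text \<open>Index 1 stands for the coset \<open>H\<close> itself, so fixing it means
  \<open>g <# H = H\<close>.\<close>

lemma (in coset_setup) coset_perm_one_imp_mem:
  assumes X1: "X 1 <# H = H" and g: "g \<in> carrier G" "coset_perm G H n X g 1 = 1"
  shows "g \<in> H"
proof -
  have "g <# (X 1 <# H) = (g \<otimes> X 1) <# H"
    using g(1) one_in_index X_carrier H_subset by (intro lcos_m_assoc) auto
  then have "g <# H = H" using coset_perm_coset[OF g(1) one_in_index] g(2) X1 by simp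
  then show ?thesis using lcos_self[OF g(1) H] by simp
qed

lemma (in coset_setup) finite_G_tilde:
  assumes "finite (carrier G)" shows "finite (carrier (G_tilde G H n X))"
  using assms finite_roots_unity[of 3, where 'a = complex]
  by (simp add: G_tilde_def semidirect_product_def carrier_C3_power finite_PiE)

text \<open>The restriction to \<open>{1..n}\<close> makes the tuple extensional, as membership in
  \<open>C3_power n\<close> requires.\<close>

definition first_axis :: "nat \<Rightarrow> complex \<Rightarrow> nat \<Rightarrow> complex" where
  "first_axis n z = (\<lambda>i\<in>{1..n}. if i = 1 then z else 1)"

lemma (in coset_setup) first_axis_mem:
  "z ^ 3 = 1 \<Longrightarrow> first_axis n z \<in> carrier (C3_power n)"
  by (auto simp: first_axis_def carrier_C3_power)

text \<open>No inverse in the semidirect product is computed: \<open>y\<close> is determined by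
  comparing \<open>x \<otimes> y\<close> with \<open>(first_axis n z, \<one>) \<otimes> x\<close>.
  The comparison is made at the position to which \<open>x\<close> moves the first coordinate of
  \<open>y\<close>, and the coordinate of \<open>x\<close> there cancels.\<close>

lemma (in coset_setup) conjugate_first_axis:
  assumes z: "z ^ 3 = 1" and x: "x \<in> carrier (G_tilde G H n X)"
  defines "y \<equiv> inv\<^bsub>G_tilde G H n X\<^esub> x \<otimes>\<^bsub>G_tilde G H n X\<^esub> (first_axis n z, \<one>) \<otimes>\<^bsub>G_tilde G H n X\<^esub> x"
  shows "y \<in> carrier (C3_power n) \<times> {\<one>}"
    and "first_coordinate y = first_axis n z (coset_perm G H n X (snd x) 1)"
proof -
  let ?Gt = "G_tilde G H n X" and ?e = "(first_axis n z, \<one>)"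
  interpret T: group ?Gt by (rule group_G_tilde)
  have car: "carrier ?Gt = carrier (C3_power n) \<times> carrier G"
    by (simp add: G_tilde_def semidirect_product_def)
  have e: "?e \<in> carrier ?Gt" using z by (simp add: car first_axis_mem)
  have y: "y \<in> carrier ?Gt" using x e by (simp add: y_def)
  have xy: "x \<otimes>\<^bsub>?Gt\<^esub> y = ?e \<otimes>\<^bsub>?Gt\<^esub> x"
    using x e by (simp add: y_def T.m_assoc[symmetric])
  obtain b g where bg: "x = (b, g)" "b \<in> carrier (C3_power n)" "g \<in> carrier G"
    using x by (auto simp: car)
  obtain c k where ck: "y = (c, k)" "c \<in> carrier (C3_power n)" "k \<in> carrier G"
    using y by (auto simp: car)
  have eqs: "b \<otimes>\<^bsub>C3_power n\<^esub> coset_action G H n X g c = first_axis n z \<otimes>\<^bsub>C3_power n\<^esub> b"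
    "g \<otimes> k = g"
    using xy bg by (simp_all add: ck(1) G_tilde_def semidirect_product_def coset_action_one)
  have "k = \<one>" using eqs(2) bg(3) ck(3) by (simp add: r_cancel_one)
  then show "y \<in> carrier (C3_power n) \<times> {\<one>}" using ck by simp
  let ?j = "coset_perm G H n X g 1"
  have j: "?j \<in> {1..n}" by (rule coset_perm_in[OF bg(3) one_in_index])
  have "b ?j * coset_action G H n X g c ?j = first_axis n z ?j * b ?j"
    using fun_cong[OF eqs(1), of ?j] j by (simp add: C3_power_def)
  moreover have "b ?j ^ 3 = 1" using bg(2) j unfolding carrier_C3_power by blast
  then have "b ?j \<noteq> 0" by auto
  ultimately have "coset_action G H n X g c ?j = first_axis n z ?j" by simp
  then show "first_coordinate y = first_axis n z (coset_perm G H n X (snd x) 1)"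
    using coset_action_perm[OF bg(3) one_in_index] bg(1) ck(1) by (simp add: first_coordinate_def)
qed

theorem theorem2p3:
  fixes G :: "('g, 'm) monoid_scheme"
    and H :: "'g set"
    and n :: nat
    and X :: "nat \<Rightarrow> 'g"
    and H' :: "((nat \<Rightarrow> complex) \<times> 'g) set"
    and \<chi>' :: "(nat \<Rightarrow> complex) \<times> 'g \<Rightarrow> complex"
  defines "Gt \<equiv> G_tilde G H n X"
    and "Ht \<equiv> H_tilde H n"
    and "\<chi> \<equiv> (first_coordinate :: (nat \<Rightarrow> complex) \<times> 'g \<Rightarrow> complex)"
  defines "U \<equiv> kernel (Gt\<lparr>carrier := Ht\<rparr>) C3 \<chi>"
    and "U' \<equiv> kernel (Gt\<lparr>carrier := H'\<rparr>) complex_units \<chi>'"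
  assumes "group G" and "finite (carrier G)"
    and "subgroup H G" and "card (lcosets\<^bsub>G\<^esub> H) = n"
    and "\<And>i. i \<in> {1..n} \<Longrightarrow> X i \<in> carrier G"
    and "bij_betw (\<lambda>i. X i <#\<^bsub>G\<^esub> H) {1..n} (lcosets\<^bsub>G\<^esub> H)"
    and "X 1 <#\<^bsub>G\<^esub> H = H"
    and "subgroup H' Gt"
    and "\<chi>' \<in> hom (Gt\<lparr>carrier := H'\<rparr>) complex_units"
    and "rep_isomorphic Gt (induced_rep Gt Ht trivial_rep) (induced_rep Gt H' trivial_rep)"
    and "rep_isomorphic Gt (induced_rep Gt U trivial_rep) (induced_rep Gt U' trivial_rep)"
  shows "rep_isomorphic Gt (induced_rep Gt Ht (character_rep \<chi>))
           (induced_rep Gt H' (character_rep \<chi>')) \<or>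
         rep_isomorphic Gt (induced_rep Gt Ht (character_rep \<chi>))
           (induced_rep Gt H' (character_rep (\<lambda>x. cnj (\<chi>' x))))"
proof -
  interpret G: group G by fact
  interpret C: coset_setup G H n X
    using assms by (simp add: coset_setup_def coset_setup_axioms_def)
  have grp: "group Gt" and fin: "finite (carrier Gt)" and sub: "subgroup Ht Gt"
    unfolding Gt_def Ht_def
    by (rule C.group_G_tilde C.finite_G_tilde C.subgroup_H_tilde \<open>finite (carrier G)\<close>)+
  have hom: "\<chi> \<in> hom (Gt\<lparr>carrier := Ht\<rparr>) C3"
    unfolding \<chi>_def Gt_def Ht_def
    by (rule C.first_coordinate_hom) fact
  have "\<chi> h \<noteq> 0" if "h \<in> Ht" for h
  proof -
    have "\<chi> h ^ 3 = 1" using hom that by (auto simp: hom_def)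
    then show ?thesis by auto
  qed
  with hom have hom': "\<chi> \<in> hom (Gt\<lparr>carrier := Ht\<rparr>) complex_units"
    by (simp add: hom_def complex_units_def)
  have axis: "(first_axis n z, \<one>\<^bsub>G\<^esub>) \<in> Ht" "\<chi> (first_axis n z, \<one>\<^bsub>G\<^esub>) = z"
    if "z ^ 3 = 1" for z
    using C.first_axis_mem[OF that] subgroup.one_closed[OF \<open>subgroup H G\<close>] C.one_in_index
    by (simp_all add: Ht_def H_tilde_def \<chi>_def first_coordinate_def first_axis_def)
  have image: "\<chi> ` Ht = {z. z ^ 3 = 1}"
  proof
    show "\<chi> ` Ht \<subseteq> {z. z ^ 3 = 1}" using hom by (auto simp: hom_def)
    show "{z. z ^ 3 = 1} \<subseteq> \<chi> ` Ht" using axis by (metis (mono_tags) image_eqI mem_Collect_eq subsetI)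
  qed
  obtain \<omega> :: complex where \<omega>: "\<omega> ^ 3 = 1" "\<omega> \<noteq> 1"
  proof (rule ccontr)
    assume "\<not> thesis"
    then have "{z :: complex. z ^ 3 = 1} \<subseteq> {1}" using that by auto
    then have "card {z :: complex. z ^ 3 = 1} \<le> card {1 :: complex}" by (intro card_mono) auto
    then show False by (simp add: card_roots_unity_eq)
  qed
  \<comment> \<open>The element required by the criterion: a nontrivial cube root of unity in the
    first coordinate and 1 in all others.\<close>
  define e where "e = (first_axis n \<omega>, \<one>\<^bsub>G\<^esub>)"
  have e: "e \<in> Ht" "\<chi> e \<noteq> 1" using axis[OF \<omega>(1)] \<omega>(2) by (simp_all add: e_def)
  have conj_mem: "inv\<^bsub>Gt\<^esub> x \<otimes>\<^bsub>Gt\<^esub> e \<otimes>\<^bsub>Gt\<^esub> x \<in> Ht" if "x \<in> carrier Gt" for x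
    using C.conjugate_first_axis(1)[OF \<omega>(1) that[unfolded Gt_def]]
      subgroup.one_closed[OF \<open>subgroup H G\<close>]
    unfolding Gt_def Ht_def H_tilde_def e_def by (auto simp only: mem_Times_iff singleton_iff)
  \<comment> \<open>Outside \<open>Ht\<close> the component in \<open>G\<close> moves the first
    coset, so the first coordinate of the conjugate is an entry of \<open>first_axis\<close> at an
    index other than 1.\<close>
  have conj_one: "\<chi> (inv\<^bsub>Gt\<^esub> x \<otimes>\<^bsub>Gt\<^esub> e \<otimes>\<^bsub>Gt\<^esub> x) = 1" if x: "x \<in> carrier Gt" "x \<notin> Ht" for x
  proof -
    have g: "snd x \<in> carrier G" "snd x \<notin> H"
      using x by (auto simp: Gt_def Ht_def H_tilde_def G_tilde_def semidirect_product_def)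
    then have "coset_perm G H n X (snd x) 1 \<noteq> 1"
      using C.coset_perm_one_imp_mem \<open>X 1 <#\<^bsub>G\<^esub> H = H\<close> by blast
    then have "first_axis n \<omega> (coset_perm G H n X (snd x) 1) = 1"
      using C.coset_perm_in[OF g(1) C.one_in_index] by (simp add: first_axis_def)
    then show ?thesis
      using C.conjugate_first_axis(2)[OF \<omega>(1) x(1)[unfolded Gt_def]]
      unfolding Gt_def \<chi>_def e_def by simp
  qed
  have A: "subgroup_character Gt Ht \<chi>"
    using grp fin sub hom' by (simp add: subgroup_character_def subgroup_character_axioms_def)
  have B: "subgroup_character Gt H' \<chi>'"
    using grp fin assms by (simp add: subgroup_character_def subgroup_character_axioms_def)
  have U: "U = {h \<in> Ht. \<chi> h = 1}" "U' = {h \<in> H'. \<chi>' h = 1}"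
    by (simp_all add: U_def U'_def kernel_def complex_units_def)
  note iso_ker =
    \<open>rep_isomorphic Gt (induced_rep Gt U trivial_rep) (induced_rep Gt U' trivial_rep)\<close>[unfolded U]
  show ?thesis
    by (rule induced_cubic_characters_isomorphic[OF A B image e conj_mem conj_one _ iso_ker])
      (assumption | fact)+
qed

end
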